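(* Let $y_{ij}=y_{ji}:\mathbb{R}\to S^{n-1}$, $(i,j)\in\mathcal{E}$, be smooth functions of time and $M_{ij}(t)=y_{ij}(t)y_{ij}(t)^T$. Assume that $\mathcal{G}(\mathcal{V},\mathcal{E})$ is connected and that: (i) $\overline{M}_{ij}:=\lim_{t\to\infty}\frac{1}{2t}\int_{-t}^{t}M_{ij}(s)\,ds$ exists and is positive definite for all $(i,j)\in\mathcal{E}$; (ii) there exists $Z:[0,+\infty)\to[0,+\infty)$ with $\lim_{t\to\infty}\tfrac1tZ(t)=0$ such that for all $t$ and all $(i,j)\in\mathcal{E}$, $\big\|\int_t^{t+T}(M_{ij}(s)-\overline{M}_{ij})\,ds\big\|_F\le Z(T)$ for all $T\ge0$. Then for all sufficiently small $\varepsilon>0$, the set $C_s$ is locally exponentially stable for the dynamics on $(SO(n))^k$ $$\tfrac{d}{dt}Q_i=\varepsilon\,Q_i\sum_{\{j:(i,j)\in\mathcal{E}\}}\mathrm{skew}(Q_i^TM_{ij}(t)Q_j),\qquad i=1,\ldots,k.$$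
   Context: $\mathcal{G}(\mathcal{V},\mathcal{E})$ is an undirected finite graph without self-loops, $\mathcal{V}=\{1,\ldots,k\}$, $k>2$; $n\ge2$. $\mathrm{skew}(X)=\tfrac12(X-X^T)$; $\|M\|_F=\sqrt{\mathrm{tr}(M^TM)}$; $S^{n-1}$ is the unit sphere of $\mathbb{R}^n$. $C_s=\{(Q_1,\ldots,Q_k)\in(SO(n))^k: Q_1=\cdots=Q_k\}$. *)

theory Defs
  imports "HOL-Analysis.Analysis"
begin

definition skew :: "real^'n^'n \<Rightarrow> real^'n^'n" where
  "skew X = (1/2) *\<^sub>R (X - transpose X)"

definition frobenius_norm :: "real^'n^'n \<Rightarrow> real" where
  "frobenius_norm A = sqrt (trace (transpose A ** A))"

definition positive_definite :: "real^'n^'n \<Rightarrow> bool" where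
  "positive_definite A \<longleftrightarrow> transpose A = A \<and> (\<forall>x. x \<noteq> 0 \<longrightarrow> x \<bullet> (A *v x) > 0)"

(* D m is the m-th derivative of f *)
definition smooth :: "(real \<Rightarrow> 'a::real_normed_vector) \<Rightarrow> bool" where
  "smooth f \<longleftrightarrow>
    (\<exists>D :: nat \<Rightarrow> real \<Rightarrow> 'a. D 0 = f \<and>
       (\<forall>m t. (D m has_vector_derivative D (Suc m) t) (at t)))"

(* y y^T; the constraint on columnvector fixes the inner dimension of the product to be 1 *)
definition outer_square :: "real^'n \<Rightarrow> real^'n^'n" where
  "outer_square y = (columnvector y :: real^1^'n) ** rowvector y"

definition simple_graph :: "('v \<times> 'v) set \<Rightarrow> bool" where
  "simple_graph E \<longleftrightarrow> sym E \<and> irrefl E"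

definition connected_graph :: "('v \<times> 'v) set \<Rightarrow> bool" where
  "connected_graph E \<longleftrightarrow> (\<forall>i j. (i, j) \<in> E\<^sup>*)"

(* SO(n)^k: a configuration Q assigns to every vertex i the matrix Q $ i *)
definition SO_product :: "(real^'n^'n^'v) set" where
  "SO_product = {Q. \<forall>i. rotation_matrix (Q $ i)}"

definition consensus_set :: "(real^'n^'n^'v) set" where
  "consensus_set = {Q \<in> SO_product. \<forall>i j. Q $ i = Q $ j}"

definition consensus_field ::
  "('v::finite \<times> 'v) set \<Rightarrow> ('v \<Rightarrow> 'v \<Rightarrow> real \<Rightarrow> real^'n^'n) \<Rightarrow> real
     \<Rightarrow> real \<Rightarrow> real^'n^'n^'v \<Rightarrow> real^'n^'n^'v" where
  "consensus_field E M \<epsilon> t Q =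
     (\<chi> i. \<epsilon> *\<^sub>R (Q $ i ** (\<Sum>j | (i, j) \<in> E. skew (transpose (Q $ i) ** M i j t ** Q $ j))))"

definition solution_on ::
  "'a::real_normed_vector set \<Rightarrow> (real \<Rightarrow> 'a \<Rightarrow> 'a) \<Rightarrow> real set \<Rightarrow> (real \<Rightarrow> 'a) \<Rightarrow> bool" where
  "solution_on X F J x \<longleftrightarrow>
     (\<forall>t\<in>J. x t \<in> X \<and> (x has_vector_derivative F t (x t)) (at t within J))"

(* Local exponential stability of the set C for x' = F t x on the state space X, uniform in the
   initial time t0. Quantifying over all compact intervals {t0..t1} of existence covers solutions
   on {t0..} as well as solutions on any shorter interval.
   On real^'n^'n^'v, infdist is taken with respect to the product of the Frobenius metrics. *)
definition locally_exponentially_stable ::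
  "'a::real_normed_vector set \<Rightarrow> (real \<Rightarrow> 'a \<Rightarrow> 'a) \<Rightarrow> 'a set \<Rightarrow> bool" where
  "locally_exponentially_stable X F C \<longleftrightarrow>
     (\<exists>\<delta>>0. \<exists>c>0. \<exists>r>0. \<forall>t0 t1 x.
        solution_on X F {t0..t1} x \<longrightarrow> infdist (x t0) C < \<delta> \<longrightarrow>
        (\<forall>t\<in>{t0..t1}. infdist (x t) C \<le> c * exp (- r * (t - t0)) * infdist (x t0) C))"

end

theory Submission
  imports Defs
begin

text \<open>Let \<open>V\<close> be the sum of \<open>|Q\<^sub>i - Q\<^sub>j|\<^sup>2\<close> over all pairs, which is comparable to the squared distance
  to the consensus set, and let \<open>D\<^sub>i\<^sub>j = Q\<^sub>j - Q\<^sub>i\<close>. Along the flow,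
  \<open>V' = - 2 \<epsilon> k \<Sum>\<^sub>E \<langle>M\<^sub>i\<^sub>j D\<^sub>i\<^sub>j, D\<^sub>i\<^sub>j\<rangle> + O(\<epsilon> V\<^sup>3\<^sup>/\<^sup>2)\<close>. Each \<open>M\<^sub>i\<^sub>j\<close> is singular, but by (ii) its mean
  \<open>P\<^sub>i\<^sub>j(t)\<close> over a window \<open>[t, t + T]\<close> is uniformly positive definite once \<open>T\<close> is large. For bounded \<open>N\<^sub>i\<^sub>j\<close>
  with \<open>N\<^sub>i\<^sub>j' = P\<^sub>i\<^sub>j - M\<^sub>i\<^sub>j\<close>, the function \<open>U = V - 2 \<epsilon> k \<Sum>\<^sub>E \<langle>N\<^sub>i\<^sub>j D\<^sub>i\<^sub>j, D\<^sub>i\<^sub>j\<rangle>\<close> satisfies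
  \<open>U' = - 2 \<epsilon> k \<Sum>\<^sub>E \<langle>P\<^sub>i\<^sub>j D\<^sub>i\<^sub>j, D\<^sub>i\<^sub>j\<rangle> + O(\<epsilon>\<^sup>2 V + \<epsilon> V\<^sup>3\<^sup>/\<^sup>2)\<close>. By connectivity the first term is at most
  a negative multiple of \<open>\<epsilon> V\<close>, and so \<open>U\<close>, which is comparable to \<open>V\<close>, decays exponentially if \<open>\<epsilon>\<close> and
  its initial value are small.\<close>

subsection \<open>Frobenius geometry of matrices\<close>

lemma inner_matrix_mult_left:
  fixes A :: "real^'m^'l" and B :: "real^'n^'m"
  shows "(A ** B) \<bullet> C = B \<bullet> (transpose A ** C)"
proof -
  have "(A ** B) \<bullet> C = (\<Sum>i\<in>UNIV. \<Sum>j\<in>UNIV. \<Sum>k\<in>UNIV. A$i$k * B$k$j * C$i$j)"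
    by (simp add: inner_vec_def matrix_matrix_mult_def sum_distrib_right)
  also have "\<dots> = (\<Sum>i\<in>UNIV. \<Sum>k\<in>UNIV. \<Sum>j\<in>UNIV. A$i$k * B$k$j * C$i$j)"
    by (intro sum.cong refl sum.swap)
  also have "\<dots> = (\<Sum>k\<in>UNIV. \<Sum>i\<in>UNIV. \<Sum>j\<in>UNIV. A$i$k * B$k$j * C$i$j)"
    by (rule sum.swap)
  also have "\<dots> = (\<Sum>k\<in>UNIV. \<Sum>j\<in>UNIV. \<Sum>i\<in>UNIV. A$i$k * B$k$j * C$i$j)"
    by (intro sum.cong refl sum.swap)
  also have "\<dots> = B \<bullet> (transpose A ** C)"
    by (simp add: inner_vec_def matrix_matrix_mult_def transpose_def sum_distrib_left mult_ac)
  finally show ?thesis .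
qed

lemma inner_transpose_transpose [simp]:
  fixes A :: "real^'n^'m"
  shows "transpose A \<bullet> transpose B = A \<bullet> B"
  by (simp add: inner_vec_def transpose_def) (rule sum.swap)

lemma norm_transpose [simp]:
  fixes A :: "real^'n^'m"
  shows "norm (transpose A) = norm A"
  by (simp add: norm_eq_sqrt_inner)

lemma frobenius_norm_eq_norm: "frobenius_norm A = norm A"
  by (simp add: frobenius_norm_def norm_eq_sqrt_inner trace_def inner_vec_def
      matrix_matrix_mult_def transpose_def) (rule sum.swap)

text \<open>Each entry of the product is the inner product of a row with a column; after
  Cauchy-Schwarz for every entry the double sum factorises.\<close>

lemma norm_matrix_mult_le:
  fixes A :: "real^'m^'l" and B :: "real^'n^'m"
  shows "norm (A ** B) \<le> norm A * norm B"
proof (rule power2_le_imp_le)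
  have "(A ** B)$i$j = A$i \<bullet> transpose B $ j" for i j
    by (simp add: matrix_matrix_mult_def inner_vec_def transpose_def)
  then have "(norm (A ** B))\<^sup>2 = (\<Sum>i\<in>UNIV. \<Sum>j\<in>UNIV. (A$i \<bullet> transpose B $ j)\<^sup>2)"
    by (simp add: power2_norm_eq_inner) (simp add: inner_vec_def power2_eq_square)
  also have "\<dots> \<le> (\<Sum>i\<in>UNIV. \<Sum>j\<in>UNIV. (A$i \<bullet> A$i) * (transpose B $ j \<bullet> transpose B $ j))"
    by (intro sum_mono Cauchy_Schwarz_ineq)
  also have "\<dots> = (A \<bullet> A) * (transpose B \<bullet> transpose B)"
    unfolding inner_vec_def[of A A] inner_vec_def[of "transpose B" "transpose B"] sum_product ..
  finally show "(norm (A ** B))\<^sup>2 \<le> (norm A * norm B)\<^sup>2"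
    by (simp add: power2_norm_eq_inner power_mult_distrib)
qed simp

lemma matrix_add_rdistrib:
  fixes A :: "real^'m^'l"
  shows "(A + B) ** C = A ** C + B ** C"
  by (simp add: vec_eq_iff matrix_matrix_mult_def algebra_simps sum.distrib)

lemma matrix_diff_ldistrib:
  fixes A :: "real^'m^'l"
  shows "A ** (B - C) = A ** B - A ** C"
  by (simp add: vec_eq_iff matrix_matrix_mult_def algebra_simps sum_subtractf)

lemma matrix_diff_rdistrib:
  fixes A :: "real^'m^'l"
  shows "(A - B) ** C = A ** C - B ** C"
  by (simp add: vec_eq_iff matrix_matrix_mult_def algebra_simps sum_subtractf)

lemma matrix_sum_ldistrib:
  fixes A :: "real^'m^'l"
  shows "A ** sum f S = (\<Sum>x\<in>S. A ** f x)"
  by (simp add: vec_eq_iff matrix_matrix_mult_def sum_distrib_left) (auto intro: sum.swap)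

lemma bounded_bilinear_matrix_mult:
  "bounded_bilinear ((**) :: real^'m^'l \<Rightarrow> real^'n^'m \<Rightarrow> real^'n^'l)"
proof
  show "\<exists>K. \<forall>(A::real^'m^'l) (B::real^'n^'m). norm (A ** B) \<le> norm A * norm B * K"
    by (rule exI[of _ 1]) (simp add: norm_matrix_mult_le)
qed (auto simp: matrix_add_ldistrib matrix_add_rdistrib
    scalar_matrix_assoc[symmetric] matrix_scalar_ac)

lemma transpose_diff:
  fixes A :: "real^'m^'l"
  shows "transpose (A - B) = transpose A - transpose B"
  by (simp add: vec_eq_iff transpose_def)

lemma norm_orthogonal_matrix:
  fixes Q :: "real^'n^'n"
  assumes "orthogonal_matrix Q"
  shows "norm Q = sqrt (CARD('n))"
proof -
  have "Q \<bullet> Q = mat 1 \<bullet> (transpose Q ** Q)"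
    using inner_matrix_mult_left[of Q "mat 1" Q] by simp
  also have "\<dots> = (\<Sum>i\<in>UNIV. \<Sum>j\<in>UNIV. (mat 1 :: real^'n^'n)$i$j * (mat 1 :: real^'n^'n)$i$j)"
    using assms by (simp add: orthogonal_matrix inner_vec_def)
  also have "\<dots> = CARD('n)"
    by (simp add: mat_def if_distrib if_distribR cong: if_cong)
  finally show ?thesis
    by (simp add: norm_eq_sqrt_inner)
qed

section \<open>Outer squares\<close>

lemma outer_square_component: "outer_square y $ i $ j = y$i * y$j"
  by (simp add: outer_square_def matrix_matrix_mult_def columnvector_def rowvector_def)

lemma transpose_outer_square [simp]: "transpose (outer_square y) = outer_square y"
  by (simp add: vec_eq_iff transpose_def outer_square_component)

lemma norm_outer_square: "norm (outer_square y) = (norm y)\<^sup>2"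
proof -
  have "outer_square y \<bullet> outer_square y = (y \<bullet> y) * (y \<bullet> y)"
    unfolding inner_vec_def sum_product
    by (simp add: outer_square_component inner_vec_def mult_ac sum_distrib_left)
  then show ?thesis
    by (simp add: norm_eq_sqrt_inner)
qed

lemma continuous_on_outer_square:
  assumes "continuous_on S y"
  shows "continuous_on S (\<lambda>t. outer_square (y t))"
proof -
  have eq: "(\<lambda>t. outer_square (y t)) = (\<lambda>t. \<chi> i j. y t $ i * y t $ j)"
    by (simp add: fun_eq_iff vec_eq_iff outer_square_component)
  show ?thesis
    unfolding eq using assms by (auto intro!: continuous_on_vec_lambda continuous_on_mult continuous_on_component)
qed

section \<open>Quadratic forms and coercivity\<close>

lemma matrix_mult_inner_ge:
  fixes A :: "real^'n^'n" and D :: "real^'m^'n"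
  assumes "\<And>x. \<mu> * (norm x)\<^sup>2 \<le> x \<bullet> (A *v x)"
  shows "\<mu> * (norm D)\<^sup>2 \<le> (A ** D) \<bullet> D"
proof -
  \<comment> \<open>The columns of \<open>D\<close> are the rows of its transpose. \<open>A\<close>
    acts on each column separately, so the matrix inequality is a sum of vector
    inequalities.\<close>
  have "transpose (A ** D) $ j = A *v (transpose D $ j)" for j
    by (simp add: vec_eq_iff matrix_matrix_mult_def matrix_vector_mult_def transpose_def)
  then have eq: "(A ** D) \<bullet> D = (\<Sum>j\<in>UNIV. transpose D $ j \<bullet> (A *v (transpose D $ j)))"
    unfolding inner_transpose_transpose[of "A ** D" D, symmetric]
      inner_vec_def[of "transpose (A ** D)" "transpose D"]
    by (simp only: inner_commute)
  have "\<mu> * (norm D)\<^sup>2 = \<mu> * (transpose D \<bullet> transpose D)"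
    by (simp add: power2_norm_eq_inner)
  also have "\<dots> = (\<Sum>j\<in>UNIV. \<mu> * (norm (transpose D $ j))\<^sup>2)"
    unfolding inner_vec_def[of "transpose D" "transpose D"]
    by (simp only: power2_norm_eq_inner sum_distrib_left)
  also have "\<dots> \<le> (A ** D) \<bullet> D"
    unfolding eq by (intro sum_mono assms)
  finally show ?thesis .
qed

text \<open>The quadratic form attains a positive minimum on the compact unit sphere, and
  homogeneity carries the bound to all vectors.\<close>

lemma positive_definite_coercive:
  fixes A :: "real^'n^'n"
  assumes "positive_definite A"
  obtains \<mu> where "\<mu> > 0" "\<And>x. \<mu> * (norm x)\<^sup>2 \<le> x \<bullet> (A *v x)"
proof -
  have "compact (sphere (0::real^'n) 1)" "sphere (0::real^'n) 1 \<noteq> {}"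
    by simp_all
  moreover have "continuous_on (sphere 0 1) (\<lambda>x. x \<bullet> (A *v x))"
    by (intro continuous_intros)
  ultimately obtain z where z: "z \<in> sphere 0 1"
    and min: "\<And>x. x \<in> sphere 0 1 \<Longrightarrow> z \<bullet> (A *v z) \<le> x \<bullet> (A *v x)"
    using continuous_attains_inf[of "sphere 0 1" "\<lambda>x. x \<bullet> (A *v x)"] by blast
  show ?thesis
  proof
    show "z \<bullet> (A *v z) > 0"
      using z assms unfolding positive_definite_def by (metis norm_zero mem_sphere_0 zero_neq_one)
    show "z \<bullet> (A *v z) * (norm x)\<^sup>2 \<le> x \<bullet> (A *v x)" for x
    proof (cases "x = 0")
      case False
      define u where "u = inverse (norm x) *\<^sub>R x"
      have x: "x = norm x *\<^sub>R u"
        using False by (simp add: u_def)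
      have "u \<in> sphere 0 1"
        using False by (simp add: u_def)
      then have "z \<bullet> (A *v z) * (norm x)\<^sup>2 \<le> (u \<bullet> (A *v u)) * (norm x)\<^sup>2"
        by (intro mult_right_mono min) auto
      also have "\<dots> = (norm x *\<^sub>R u) \<bullet> (A *v (norm x *\<^sub>R u))"
        by (simp add: matrix_vector_mult_scaleR power2_eq_square mult_ac)
      also have "\<dots> = x \<bullet> (A *v x)"
        using x by simp
      finally show ?thesis .
    qed simp
  qed
qed

subsection \<open>Moving averages and differential inequalities\<close>

lemma smooth_imp_continuous_on: "smooth f \<Longrightarrow> continuous_on S f"
  unfolding smooth_def
  by (metis continuous_at_imp_continuous_on has_vector_derivative_continuous)

text \<open>Used to trade a singular matrix for its window mean. The corrector stays bounded for all
  time because an antiderivative of \<open>f\<close> is \<open>B\<close>-Lipschitz and so varies by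
  at most \<open>B * T\<close> over a window.\<close>

lemma moving_average_corrector:
  fixes f :: "real \<Rightarrow> 'a::euclidean_space"
  assumes cont: "continuous_on UNIV f" and bound: "\<And>t. norm (f t) \<le> B" and "T > 0"
  obtains N where
    "\<And>t. (N has_vector_derivative (1/T) *\<^sub>R integral {t..t+T} f - f t) (at t)"
    "\<And>t. norm (N t) \<le> B * T"
proof -
  have antideriv: "\<exists>F. \<forall>t. (F has_vector_derivative g t) (at t)"
    if "continuous_on UNIV g" for g :: "real \<Rightarrow> 'a"
    using einterval_antiderivative[of "-\<infinity>" "\<infinity>" g] that
    by (auto simp: continuous_on_eq_continuous_at)
  obtain G where G: "\<And>t. (G has_vector_derivative f t) (at t)"
    using antideriv[OF cont] by blast
  then have "continuous_on UNIV G"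
    by (meson continuous_at_imp_continuous_on has_vector_derivative_continuous)
  then obtain H where H: "\<And>t. (H has_vector_derivative G t) (at t)"
    using antideriv by blast
  have int: "(f has_integral G s - G t) {t..s}" if "t \<le> s" for s t
    using that G by (intro fundamental_theorem_of_calculus)
      (auto intro: has_vector_derivative_at_within)
  have "B \<ge> 0"
    using bound[of 0] norm_ge_zero order_trans by blast
  have G_bound: "norm (G s - G t) \<le> B * (s - t)" if "t \<le> s" for s t
    using has_integral_bound_real[OF \<open>B \<ge> 0\<close> finite.emptyI int[OF that]] bound that by simp
  \<comment> \<open>The mean of \<open>G\<close> over the window minus \<open>G t\<close>, so that the mean of \<open>f\<close> appears on differentiating.\<close>
  define N where "N t = (1/T) *\<^sub>R (H (t + T) - H t) - G t" for t
  show ?thesis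
  proof
    fix t
    have "((\<lambda>t. H (t + T)) has_vector_derivative G (t + T)) (at t)"
      using vector_diff_chain_at[of "\<lambda>t. t + T" 1 t H "G (t + T)"] H
        has_vector_derivative_add_const[of "\<lambda>t. t" T 1 "at t"]
      by (simp add: o_def)
    then have "(N has_vector_derivative (1/T) *\<^sub>R (G (t + T) - G t) - f t) (at t)"
      unfolding N_def using G H
      by (auto intro!: derivative_eq_intros has_vector_derivative_diff simp: scaleR_diff_right)
    moreover have "integral {t..t+T} f = G (t + T) - G t"
      using int[of t "t + T"] \<open>T > 0\<close> by (simp add: integral_unique)
    ultimately show "(N has_vector_derivative (1/T) *\<^sub>R integral {t..t+T} f - f t) (at t)"
      by simp
    \<comment> \<open>Up to the factor \<open>T\<close>, the corrector is the error of linearising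
      \<open>H\<close> at \<open>t\<close>, which the mean value inequality controls.\<close>
    have "norm (H (t + T) - H t - (t + T - t) *\<^sub>R G t) \<le> norm (t + T - t) * (B * T)"
    proof (rule vector_differentiable_bound_linearization[where S = "{t..t+T}"])
      show "norm (G s - G t) \<le> B * T" if "s \<in> {t..t+T}" for s
      proof -
        have "norm (G s - G t) \<le> B * (s - t)"
          using that G_bound by simp
        also have "\<dots> \<le> B * T"
          using that \<open>B \<ge> 0\<close> by (intro mult_left_mono) auto
        finally show ?thesis .
      qed
    qed (use H \<open>T > 0\<close> in \<open>auto intro: has_vector_derivative_at_within simp: closed_segment_eq_real_ivl\<close>)
    moreover have "H (t + T) - H t - (t + T - t) *\<^sub>R G t = T *\<^sub>R N t"
      using \<open>T > 0\<close> by (simp add: N_def scaleR_diff_right)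
    ultimately show "norm (N t) \<le> B * T"
      using \<open>T > 0\<close> by (simp add: mult_ac)
  qed
qed

text \<open>A continuation argument: the differential inequality is available only below the barrier
  \<open>m\<close>, but the decay it yields prevents \<open>U\<close> from ever reaching the
  barrier.\<close>

lemma barrier_exponential_decay:
  fixes U U' :: "real \<Rightarrow> real"
  assumes deriv: "\<And>t. t \<in> {a..b} \<Longrightarrow> (U has_real_derivative U' t) (at t within {a..b})"
    and nonneg: "\<And>t. t \<in> {a..b} \<Longrightarrow> 0 \<le> U t" and init: "U a < m" and "r \<ge> 0"
    and decay: "\<And>t. t \<in> {a..b} \<Longrightarrow> U t < m \<Longrightarrow> U' t \<le> - r * U t"
    and t: "t \<in> {a..b}"
  shows "U t \<le> exp (- r * (t - a)) * U a"
proof -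
  have cont: "continuous_on {a..b} U"
    using deriv by (meson DERIV_continuous continuous_on_eq_continuous_within)
  \<comment> \<open>Gronwall with the integrating factor \<open>exp (r * s)\<close>. Only times
    strictly before \<open>c\<close> must lie below the barrier, so the estimate also covers the
    first hitting time.\<close>
  have below: "U c \<le> exp (- r * (c - a)) * U a"
    if c: "c \<in> {a..b}" and less: "\<And>s. s \<in> {a..<c} \<Longrightarrow> U s < m" for c
  proof -
    have "exp (r * c) * U c \<le> exp (r * a) * U a"
    proof (rule DERIV_nonpos_imp_decreasing_open[where f = "\<lambda>s. exp (r * s) * U s"])
      fix s assume s: "a < s" "s < c"
      then have "(U has_real_derivative U' s) (at s)"
        using deriv[of s] c by (simp add: at_within_Icc_at)
      then have "((\<lambda>s. exp (r * s) * U s) has_real_derivative exp (r * s) * (r * U s + U' s)) (at s)"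
        by (auto intro!: derivative_eq_intros simp: algebra_simps)
      moreover have "exp (r * s) * (r * U s + U' s) \<le> 0"
        using decay[of s] less[of s] s c by (simp add: mult_le_0_iff)
      ultimately show "\<exists>y. ((\<lambda>s. exp (r * s) * U s) has_real_derivative y) (at s) \<and> y \<le> 0"
        by blast
    next
      show "continuous_on {a..c} (\<lambda>s. exp (r * s) * U s)"
        using c by (auto intro!: continuous_intros continuous_on_subset[OF cont])
    qed (use c in auto)
    then have "U c \<le> exp (r * a) / exp (r * c) * U a"
      by (simp add: pos_le_divide_eq mult.commute)
    also have "exp (r * a) / exp (r * c) = exp (- r * (c - a))"
      by (simp add: exp_diff[symmetric] algebra_simps)
    finally show ?thesis .
  qed
  \<comment> \<open>By compactness there would be a first time \<open>c\<close> at or above the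
    barrier; the estimate there gives \<open>U c \<le> U a < m\<close>.\<close>
  have "U s < m" if "s \<in> {a..b}" for s
  proof (rule ccontr)
    assume "\<not> U s < m"
    then have "{s \<in> {a..b}. m \<le> U s} \<noteq> {}"
      using that by auto
    moreover have "compact {s \<in> {a..b}. m \<le> U s}"
    proof -
      have "closed ({a..b} \<inter> U -` {m..})"
        using cont by (intro continuous_closed_preimage) auto
      then have "compact ({a..b} \<inter> ({a..b} \<inter> U -` {m..}))"
        by (intro compact_Int_closed) auto
      moreover have "{a..b} \<inter> ({a..b} \<inter> U -` {m..}) = {s \<in> {a..b}. m \<le> U s}"
        by auto
      ultimately show ?thesis
        by simp
    qed
    ultimately obtain c where c: "c \<in> {s \<in> {a..b}. m \<le> U s}"
      and first: "\<And>s. s \<in> {s \<in> {a..b}. m \<le> U s} \<Longrightarrow> c \<le> s"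
      using compact_attains_inf[of "{s \<in> {a..b}. m \<le> U s}"] by blast
    have "U c \<le> exp (- r * (c - a)) * U a"
    proof (rule below)
      show "U s < m" if "s \<in> {a..<c}" for s
        using first[of s] that c by force
    qed (use c in auto)
    also have "\<dots> \<le> 1 * U a"
      using nonneg[of a] \<open>r \<ge> 0\<close> c by (intro mult_right_mono) auto
    finally show False
      using c init by simp
  qed
  then show ?thesis
    using t by (intro below) auto
qed

subsection \<open>The pairwise disagreement along the consensus dynamics\<close>

text \<open>For symmetric \<open>M\<close> the expression vanishes at \<open>P = Q\<close>, since
  \<open>transpose Q ** M ** Q\<close> is symmetric; hence it depends linearly on
  \<open>P - Q\<close>.\<close>

lemma orthogonal_mult_skew:
  fixes Q P M :: "real^'n^'n"
  assumes "orthogonal_matrix Q" and "transpose M = M"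
  shows "Q ** skew (transpose Q ** M ** P)
    = (1/2) *\<^sub>R (M ** (P - Q) - Q ** (transpose (P - Q) ** M ** Q))"
proof -
  have QQ: "transpose Q ** Q = mat 1" "Q ** transpose Q = mat 1"
    using assms(1) by (auto simp: orthogonal_matrix_def)
  have "Q ** (transpose Q ** M ** P) = M ** P"
    using QQ by (simp add: matrix_mul_assoc)
  moreover have "Q ** (transpose Q ** M ** Q) = M ** Q"
    using QQ by (simp add: matrix_mul_assoc)
  moreover have "transpose (transpose Q ** M ** P) = transpose P ** M ** Q"
    using assms(2) by (simp add: matrix_transpose_mul matrix_mul_assoc)
  ultimately show ?thesis
    by (simp add: skew_def matrix_scalar_ac scalar_matrix_assoc[symmetric] scaleR_diff_right
        matrix_diff_ldistrib matrix_diff_rdistrib transpose_diff)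
qed

text \<open>The point of the identity is that the last term is cubic in the differences of the
  configuration: on orthogonal matrices, \<open>Q\<^sup>T (Q - R)\<close> is skew up to the quadratic term
  \<open>(Q - R)\<^sup>T (Q - R)\<close>.\<close>

lemma inner_orthogonal_mult_skew:
  fixes Q P M R :: "real^'n^'n"
  assumes Q: "orthogonal_matrix Q" and R: "orthogonal_matrix R" and M: "transpose M = M"
  shows "(Q ** skew (transpose Q ** M ** P)) \<bullet> (Q - R)
    = (M ** (P - Q)) \<bullet> (Q - R)
      - (1/2) * ((transpose (P - Q) ** M ** Q) \<bullet> (transpose (Q - R) ** (Q - R)))"
proof -
  define A where "A = transpose (P - Q) ** M ** Q"
  have QQ: "transpose Q ** Q = mat 1" "Q ** transpose Q = mat 1" "transpose R ** R = mat 1"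
    using Q R by (auto simp: orthogonal_matrix_def)
  have "transpose (Q - R) ** (Q - R) = transpose Q ** (Q - R) + transpose (Q - R) ** Q"
    using QQ by (simp add: transpose_diff matrix_diff_ldistrib matrix_diff_rdistrib)
  then have "A \<bullet> (transpose (Q - R) ** (Q - R))
      = A \<bullet> (transpose Q ** (Q - R)) + A \<bullet> (transpose (Q - R) ** Q)"
    by (simp add: inner_right_distrib)
  also have "A \<bullet> (transpose Q ** (Q - R)) = (Q ** A) \<bullet> (Q - R)"
    by (simp add: inner_matrix_mult_left)
  also have "A \<bullet> (transpose (Q - R) ** Q) = transpose A \<bullet> (transpose Q ** (Q - R))"
    using inner_transpose_transpose[of A "transpose (Q - R) ** Q"]
    by (simp add: matrix_transpose_mul)
  also have "transpose A = transpose Q ** (M ** (P - Q))"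
    using M by (simp add: A_def matrix_transpose_mul)
  also have "\<dots> \<bullet> (transpose Q ** (Q - R)) = (M ** (P - Q)) \<bullet> (Q - R)"
    using inner_matrix_mult_left[of "transpose Q" "M ** (P - Q)"] QQ
    by (simp add: matrix_mul_assoc)
  finally show ?thesis
    unfolding orthogonal_mult_skew[OF Q M] A_def
    by (simp add: inner_diff_left field_simps)
qed

text \<open>All ordered pairs enter, not only the edges: for each fixed reference vertex the edge
  sum in the derivative can then be antisymmetrised, and the reference drops out of its leading
  part.\<close>

definition disagreement :: "real^'n^'n^'v \<Rightarrow> real" where
  "disagreement Q = (\<Sum>i\<in>UNIV. \<Sum>j\<in>UNIV. (norm (Q$i - Q$j))\<^sup>2)"

lemma disagreement_nonneg: "0 \<le> disagreement Q"
  by (simp add: disagreement_def sum_nonneg)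

lemma norm_diff_le_disagreement: "norm (Q$i - Q$j) \<le> sqrt (disagreement Q)"
proof (rule real_le_rsqrt)
  have "(norm (Q$i - Q$j))\<^sup>2 \<le> (\<Sum>j\<in>UNIV. (norm (Q$i - Q$j))\<^sup>2)"
    by (rule member_le_sum) auto
  also have "\<dots> \<le> disagreement Q"
    unfolding disagreement_def
    by (rule member_le_sum[where f = "\<lambda>i. \<Sum>j\<in>UNIV. (norm (Q$i - Q$j))\<^sup>2"]) (auto intro: sum_nonneg)
  finally show "(norm (Q$i - Q$j))\<^sup>2 \<le> disagreement Q" .
qed

lemma edge_difference_le_disagreement:
  fixes Q :: "real^'n^'n^'v::finite"
  shows "(\<Sum>(i, j)\<in>E. (norm (Q$j - Q$i))\<^sup>2) \<le> disagreement Q"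
proof -
  have "(\<Sum>(i, j)\<in>E. (norm (Q$j - Q$i))\<^sup>2) \<le> (\<Sum>(i, j)\<in>UNIV \<times> UNIV. (norm (Q$j - Q$i))\<^sup>2)"
    by (rule sum_mono2) auto
  also have "\<dots> = disagreement Q"
    by (simp add: disagreement_def sum.cartesian_product norm_minus_commute)
  finally show ?thesis .
qed

text \<open>A non-sharp spectral gap of the graph Laplacian: the triangle inequality along a path
  bounds every pair by edge differences, and there are finitely many pairs.\<close>

lemma disagreement_le_edge_difference:
  fixes E :: "('v::finite \<times> 'v) set"
  assumes "connected_graph E"
  obtains c where "c > 0" "\<And>Q :: real^'n^'n^'v.
    c * disagreement Q \<le> (\<Sum>(i, j)\<in>E. (norm (Q$j - Q$i))\<^sup>2)"
proof -
  define w where "w Q = (\<Sum>(i, j)\<in>E. (norm (Q$j - Q$i))\<^sup>2)" for Q :: "real^'n^'n^'v"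
  have w_nonneg: "0 \<le> w Q" for Q
    unfolding w_def by (intro sum_nonneg) auto
  have edge: "(norm (Q$j - Q$i))\<^sup>2 \<le> w Q" if "(i, j) \<in> E" for i j Q
    unfolding w_def
    using member_le_sum[of "(i, j)" E "\<lambda>(i, j). (norm (Q$j - Q$i))\<^sup>2"] that by auto
  \<comment> \<open>Induction along a path from \<open>i\<close> to \<open>j\<close>. The constant
    is chosen before \<open>Q\<close>, so it depends on the path only.\<close>
  have "\<exists>c\<ge>0. \<forall>Q. (norm (Q$i - Q$j))\<^sup>2 \<le> c * w Q" for i j
  proof -
    have "(i, j) \<in> E\<^sup>*"
      using assms by (simp add: connected_graph_def)
    then show ?thesis
    proof induction
      case base
      show ?case
        by (intro exI[of _ 0]) simp
    next
      case (step j k)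
      then obtain c where c: "c \<ge> 0" "\<And>Q. (norm (Q$i - Q$j))\<^sup>2 \<le> c * w Q"
        by blast
      have "(norm (Q$i - Q$k))\<^sup>2 \<le> (2 * c + 2) * w Q" for Q
      proof -
        have "norm (Q$i - Q$k) \<le> norm (Q$i - Q$j) + norm (Q$k - Q$j)"
          using norm_triangle_ineq4[of "Q$i - Q$j" "Q$k - Q$j"] by simp
        then have "(norm (Q$i - Q$k))\<^sup>2 \<le> (norm (Q$i - Q$j) + norm (Q$k - Q$j))\<^sup>2"
          by (intro power_mono) auto
        also have "\<dots> \<le> 2 * (norm (Q$i - Q$j))\<^sup>2 + 2 * (norm (Q$k - Q$j))\<^sup>2"
          by (smt (verit) sum_squares_bound power2_sum)
        also have "\<dots> \<le> (2 * c + 2) * w Q"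
          using c(2)[of Q] edge[OF step(2), of Q] by (simp add: algebra_simps)
        finally show ?thesis .
      qed
      then show ?case
        using c(1) by (intro exI[of _ "2 * c + 2"]) auto
    qed
  qed
  then obtain c where c: "\<And>i j. c i j \<ge> 0" "\<And>i j Q. (norm (Q$i - Q$j))\<^sup>2 \<le> c i j * w Q"
    by metis
  \<comment> \<open>The \<open>+ 1\<close> makes the constant positive, so that it can be
    inverted.\<close>
  define C where "C = (\<Sum>i\<in>UNIV. \<Sum>j\<in>UNIV. c i j) + 1"
  have "C > 0"
    unfolding C_def using c(1) by (smt (verit) sum_nonneg)
  have "disagreement Q \<le> C * w Q" for Q
  proof -
    have "disagreement Q \<le> (\<Sum>i\<in>UNIV. \<Sum>j\<in>UNIV. c i j * w Q)"
      unfolding disagreement_def by (intro sum_mono c(2))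
    also have "\<dots> = (C - 1) * w Q"
      by (simp add: C_def sum_distrib_right)
    also have "\<dots> \<le> C * w Q"
      using w_nonneg by (intro mult_right_mono) auto
    finally show ?thesis .
  qed
  then show ?thesis
    using that[of "1 / C"] \<open>C > 0\<close> by (simp add: field_simps w_def)
qed

text \<open>Summation by parts on the graph: pairing the edge \<open>(i, j)\<close> with its
  reversal flips the sign of the first factor, so the common reference \<open>P\<close>
  cancels.\<close>

lemma sum_edges_antisymmetrize:
  fixes E :: "('v::finite \<times> 'v) set" and M :: "'v \<Rightarrow> 'v \<Rightarrow> real^'n^'n"
  assumes "sym E" and M: "\<And>i j. (i, j) \<in> E \<Longrightarrow> M i j = M j i"
  shows "(\<Sum>(i, j)\<in>E. (M i j ** (Q$j - Q$i)) \<bullet> (Q$i - P))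
    = - (1/2) * (\<Sum>(i, j)\<in>E. (M i j ** (Q$j - Q$i)) \<bullet> (Q$j - Q$i))"
proof -
  define h where "h i j = (M i j ** (Q$j - Q$i)) \<bullet> (Q$i - P)" for i j
  have "bij_betw prod.swap E E"
    using \<open>sym E\<close> by (intro bij_betwI[where g = prod.swap]) (auto dest: symD)
  then have swap: "(\<Sum>(i, j)\<in>E. h i j) = (\<Sum>(i, j)\<in>E. h j i)"
    using sum.reindex_bij_betw[of prod.swap E E "\<lambda>(i, j). h i j"]
    by (simp add: case_prod_unfold)
  have "h i j + h j i = - ((M i j ** (Q$j - Q$i)) \<bullet> (Q$j - Q$i))" if "(i, j) \<in> E" for i j
  proof -
    have "h j i = - ((M i j ** (Q$j - Q$i)) \<bullet> (Q$j - P))"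
      using M[OF that] by (simp add: h_def matrix_diff_ldistrib inner_diff_left)
    then show ?thesis
      by (simp add: h_def inner_diff_right)
  qed
  then have "(\<Sum>(i, j)\<in>E. h i j) + (\<Sum>(i, j)\<in>E. h j i)
      = (\<Sum>(i, j)\<in>E. - ((M i j ** (Q$j - Q$i)) \<bullet> (Q$j - Q$i)))"
    unfolding sum.distrib[symmetric] by (intro sum.cong) auto
  then show ?thesis
    using swap by (simp add: h_def case_prod_unfold sum_negf)
qed

text \<open>Every summand is linear in \<open>Q$j - Q$i\<close>. The direct term contributes the
  factor 1, the transposed one the squared norm \<open>CARD('n)\<close> of an orthogonal matrix, and
  there are at most \<open>CARD('v)\<close> neighbours.\<close>

lemma norm_consensus_field_le:
  fixes E :: "('v::finite \<times> 'v) set" and Q :: "real^'n^'n^'v"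
  assumes Q: "Q \<in> SO_product" and "\<epsilon> \<ge> 0"
    and M: "\<And>i j. (i, j) \<in> E \<Longrightarrow> transpose (M i j t) = M i j t"
      "\<And>i j. (i, j) \<in> E \<Longrightarrow> norm (M i j t) \<le> 1"
  shows "norm (consensus_field E M \<epsilon> t Q $ i)
    \<le> \<epsilon> * (CARD('v) * (1 + CARD('n))) * sqrt (disagreement Q)"
proof -
  define d where "d = sqrt (disagreement Q)"
  have orth: "orthogonal_matrix (Q$i)" for i
    using Q by (simp add: SO_product_def rotation_matrix_def)
  have le: "norm (Q$i ** skew (transpose (Q$i) ** M i j t ** Q$j)) \<le> (1 + CARD('n)) * d"
    if ij: "(i, j) \<in> E" for j
  proof -
    define D where "D = Q$j - Q$i"
    have D: "norm D \<le> d"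
      unfolding D_def d_def by (rule norm_diff_le_disagreement)
    have "norm (M i j t ** D) \<le> 1 * norm D"
      using norm_matrix_mult_le M(2)[OF ij] by (meson mult_right_mono norm_ge_zero order_trans)
    moreover have "norm (Q$i ** (transpose D ** M i j t ** Q$i)) \<le> CARD('n) * norm D"
    proof -
      have "norm (Q$i ** (transpose D ** M i j t ** Q$i))
          \<le> norm (Q$i) * (norm D * norm (M i j t) * norm (Q$i))"
        by (intro order_trans[OF norm_matrix_mult_le] mult_left_mono mult_right_mono)
          (use norm_matrix_mult_le[of "transpose D"] in auto)
      also have "\<dots> \<le> norm (Q$i) * (norm D * 1 * norm (Q$i))"
        using M(2)[OF ij] by (intro mult_left_mono mult_right_mono) auto
      also have "\<dots> = CARD('n) * norm D"
        using norm_orthogonal_matrix[OF orth[of i]] by simp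
      finally show ?thesis .
    qed
    ultimately have "norm (M i j t ** D - Q$i ** (transpose D ** M i j t ** Q$i))
        \<le> (1 + CARD('n)) * norm D"
      using norm_triangle_ineq4[of "M i j t ** D" "Q$i ** (transpose D ** M i j t ** Q$i)"]
      by (simp add: algebra_simps)
    also have "\<dots> \<le> (1 + CARD('n)) * d"
      using D by (intro mult_left_mono) auto
    finally have "norm (M i j t ** D - Q$i ** (transpose D ** M i j t ** Q$i))
        \<le> (1 + CARD('n)) * d" .
    \<comment> \<open>The factor 1/2 coming from \<open>skew\<close> is simply dropped, which needs
      a nonnegative bound.\<close>
    moreover have "0 \<le> (1 + CARD('n)) * d"
      by (simp add: d_def disagreement_nonneg)
    ultimately show ?thesis
      unfolding orthogonal_mult_skew[OF orth M(1)[OF ij]] D_def[symmetric] by simp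
  qed
  have "d \<ge> 0"
    by (simp add: d_def disagreement_nonneg)
  define S where "S = (\<Sum>j | (i, j) \<in> E. Q$i ** skew (transpose (Q$i) ** M i j t ** Q$j))"
  have "norm S
      \<le> (\<Sum>j | (i, j) \<in> E. (1 + CARD('n)) * d)"
    unfolding S_def by (intro sum_norm_le) (use le in auto)
  also have "\<dots> \<le> (\<Sum>j\<in>(UNIV::'v set). (1 + CARD('n)) * d)"
    using \<open>d \<ge> 0\<close> by (intro sum_mono2) auto
  finally have "\<epsilon> * norm S \<le> \<epsilon> * (CARD('v) * (1 + CARD('n)) * d)"
    using \<open>\<epsilon> \<ge> 0\<close> by (intro mult_left_mono) (auto simp: algebra_simps)
  moreover have "consensus_field E M \<epsilon> t Q $ i = \<epsilon> *\<^sub>R S"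
    by (simp add: consensus_field_def matrix_sum_ldistrib S_def)
  ultimately show ?thesis
    using \<open>\<epsilon> \<ge> 0\<close> by (simp add: d_def mult.assoc)
qed

text \<open>The left side is the derivative of \<open>disagreement\<close> along the field. Each
  reference vertex \<open>l\<close> yields the same quadratic edge form, whence the factor
  \<open>CARD('v)\<close>, plus a cubic remainder \<open>e l i j\<close> per edge.\<close>

lemma disagreement_decrease:
  fixes E :: "('v::finite \<times> 'v) set" and Q :: "real^'n^'n^'v"
  assumes Q: "Q \<in> SO_product" and "\<epsilon> \<ge> 0" and "sym E"
    and M: "\<And>i j. (i, j) \<in> E \<Longrightarrow> M i j t = M j i t"
      "\<And>i j. (i, j) \<in> E \<Longrightarrow> transpose (M i j t) = M i j t"
      "\<And>i j. (i, j) \<in> E \<Longrightarrow> norm (M i j t) \<le> 1"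
  shows "4 * (\<Sum>i\<in>UNIV. \<Sum>l\<in>UNIV. consensus_field E M \<epsilon> t Q $ i \<bullet> (Q$i - Q$l))
    \<le> - 2 * \<epsilon> * CARD('v) * (\<Sum>(i, j)\<in>E. (M i j t ** (Q$j - Q$i)) \<bullet> (Q$j - Q$i))
      + 2 * \<epsilon> * (CARD('v) * card E * CARD('n)) * sqrt (disagreement Q) * disagreement Q"
proof -
  define d where "d = sqrt (disagreement Q)"
  have "d \<ge> 0" and d2: "d\<^sup>2 = disagreement Q"
    by (simp_all add: d_def disagreement_nonneg)
  have norm_d: "norm (Q$i - Q$j) \<le> d" for i j
    unfolding d_def by (rule norm_diff_le_disagreement)
  have orth: "orthogonal_matrix (Q$i)" for i
    using Q by (simp add: SO_product_def rotation_matrix_def)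
  define e where "e l i j = (transpose (Q$j - Q$i) ** M i j t ** Q$i)
    \<bullet> (transpose (Q$i - Q$l) ** (Q$i - Q$l))" for l i j
  have e_bound: "\<bar>e l i j\<bar> \<le> CARD('n) * (d * d\<^sup>2)" if ij: "(i, j) \<in> E" for l i j
  proof -
    \<comment> \<open>The norm is the square root of the dimension; the coarser bound keeps roots
      out of the constants.\<close>
    have n: "norm (Q$i) \<le> CARD('n)"
    proof -
      have "sqrt (CARD('n)) \<le> sqrt ((CARD('n))\<^sup>2)"
        by (intro real_sqrt_le_mono) (simp add: power2_eq_square)
      then show ?thesis
        using norm_orthogonal_matrix[OF orth[of i]] by simp
    qed
    have "\<bar>e l i j\<bar> \<le> norm (transpose (Q$j - Q$i) ** M i j t ** Q$i)
        * norm (transpose (Q$i - Q$l) ** (Q$i - Q$l))"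
      unfolding e_def by (rule Cauchy_Schwarz_ineq2)
    also have "\<dots> \<le> (d * 1 * CARD('n)) * (d * d)"
    proof (intro mult_mono)
      show "norm (transpose (Q$j - Q$i) ** M i j t ** Q$i) \<le> d * 1 * CARD('n)"
        using \<open>d \<ge> 0\<close> norm_d M(3)[OF ij] n
        by (intro order_trans[OF norm_matrix_mult_le] mult_mono) auto
      show "norm (transpose (Q$i - Q$l) ** (Q$i - Q$l)) \<le> d * d"
        using \<open>d \<ge> 0\<close> norm_d by (intro order_trans[OF norm_matrix_mult_le] mult_mono) auto
    qed (use \<open>d \<ge> 0\<close> in auto)
    finally show ?thesis
      by (simp add: power2_eq_square mult_ac)
  qed
  have "(\<Sum>i\<in>UNIV. \<Sum>l\<in>UNIV. consensus_field E M \<epsilon> t Q $ i \<bullet> (Q$i - Q$l))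
      = (\<Sum>l\<in>UNIV. \<Sum>i\<in>UNIV. consensus_field E M \<epsilon> t Q $ i \<bullet> (Q$i - Q$l))"
    by (rule sum.swap)
  also have "\<dots> = (\<Sum>l\<in>UNIV. \<epsilon> * (\<Sum>(i, j)\<in>E.
      (Q$i ** skew (transpose (Q$i) ** M i j t ** Q$j)) \<bullet> (Q$i - Q$l)))"
  proof (rule sum.cong[OF refl])
    fix l
    have "(\<Sum>i\<in>UNIV. consensus_field E M \<epsilon> t Q $ i \<bullet> (Q$i - Q$l))
      = \<epsilon> * (\<Sum>i\<in>UNIV. \<Sum>j | (i, j) \<in> E.
          (Q$i ** skew (transpose (Q$i) ** M i j t ** Q$j)) \<bullet> (Q$i - Q$l))"
      by (simp add: consensus_field_def matrix_sum_ldistrib inner_sum_left sum_distrib_left)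
    also have "(\<Sum>i\<in>UNIV. \<Sum>j | (i, j) \<in> E.
          (Q$i ** skew (transpose (Q$i) ** M i j t ** Q$j)) \<bullet> (Q$i - Q$l))
      = (\<Sum>(i, j)\<in>(SIGMA i:UNIV. {j. (i, j) \<in> E}).
          (Q$i ** skew (transpose (Q$i) ** M i j t ** Q$j)) \<bullet> (Q$i - Q$l))"
      by (rule sum.Sigma) auto
    also have "(SIGMA i:UNIV. {j. (i, j) \<in> E}) = E"
      by auto
    finally show "(\<Sum>i\<in>UNIV. consensus_field E M \<epsilon> t Q $ i \<bullet> (Q$i - Q$l))
      = \<epsilon> * (\<Sum>(i, j)\<in>E. (Q$i ** skew (transpose (Q$i) ** M i j t ** Q$j)) \<bullet> (Q$i - Q$l))" .
  qed
  also have "\<dots> = (\<Sum>l\<in>UNIV. \<epsilon> * (\<Sum>(i, j)\<in>E.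
      (M i j t ** (Q$j - Q$i)) \<bullet> (Q$i - Q$l) - (1/2) * e l i j))"
    unfolding e_def
    by (intro sum.cong arg_cong[where f = "\<lambda>x. \<epsilon> * x"] refl)
      (auto simp: inner_orthogonal_mult_skew[OF orth orth M(2)])
  \<comment> \<open>Antisymmetrising removes \<open>l\<close> from the leading term, leaving it only
    in the remainder.\<close>
  also have "\<dots> = (\<Sum>l\<in>(UNIV::'v set). \<epsilon> * (- (1/2) *
      (\<Sum>(i, j)\<in>E. (M i j t ** (Q$j - Q$i)) \<bullet> (Q$j - Q$i)) - (1/2) * (\<Sum>(i, j)\<in>E. e l i j)))"
  proof (intro sum.cong refl arg_cong[where f = "\<lambda>x. \<epsilon> * x"])
    fix l
    have "(\<Sum>(i, j)\<in>E. (M i j t ** (Q$j - Q$i)) \<bullet> (Q$i - Q$l) - (1/2) * e l i j)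
        = (\<Sum>(i, j)\<in>E. (M i j t ** (Q$j - Q$i)) \<bullet> (Q$i - Q$l)) - (1/2) * (\<Sum>(i, j)\<in>E. e l i j)"
      unfolding case_prod_unfold sum_subtractf sum_distrib_left ..
    then show "(\<Sum>(i, j)\<in>E. (M i j t ** (Q$j - Q$i)) \<bullet> (Q$i - Q$l) - (1/2) * e l i j)
        = - (1/2) * (\<Sum>(i, j)\<in>E. (M i j t ** (Q$j - Q$i)) \<bullet> (Q$j - Q$i))
          - (1/2) * (\<Sum>(i, j)\<in>E. e l i j)"
      using sum_edges_antisymmetrize[OF \<open>sym E\<close>, of "\<lambda>i j. M i j t" Q "Q$l", OF M(1)] by simp
  qed
  also have "\<dots> \<le> (\<Sum>l\<in>(UNIV::'v set). \<epsilon> * (- (1/2) *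
      (\<Sum>(i, j)\<in>E. (M i j t ** (Q$j - Q$i)) \<bullet> (Q$j - Q$i))
      + (1/2) * (card E * (CARD('n) * (d * d\<^sup>2)))))"
  proof (intro sum_mono mult_left_mono \<open>\<epsilon> \<ge> 0\<close>)
    fix l
    have "\<bar>\<Sum>(i, j)\<in>E. e l i j\<bar> \<le> (\<Sum>(i, j)\<in>E. \<bar>e l i j\<bar>)"
      using sum_abs[of "\<lambda>(i, j). e l i j" E] by (simp add: case_prod_unfold)
    also have "\<dots> \<le> (\<Sum>(i, j)\<in>E. CARD('n) * (d * d\<^sup>2))"
      by (intro sum_mono) (use e_bound in auto)
    finally show "- (1/2) * (\<Sum>(i, j)\<in>E. (M i j t ** (Q$j - Q$i)) \<bullet> (Q$j - Q$i))
          - (1/2) * (\<Sum>(i, j)\<in>E. e l i j)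
        \<le> - (1/2) * (\<Sum>(i, j)\<in>E. (M i j t ** (Q$j - Q$i)) \<bullet> (Q$j - Q$i))
          + (1/2) * (card E * (CARD('n) * (d * d\<^sup>2)))"
      by simp
  qed
  finally show ?thesis
    unfolding d2[symmetric] using \<open>d \<ge> 0\<close> by (simp add: algebra_simps)
qed

section \<open>Disagreement versus distance to the consensus set\<close>

lemma infdist_consensus_set_le:
  fixes Q :: "real^'n^'n^'v::finite"
  assumes "Q \<in> SO_product"
  shows "infdist Q consensus_set \<le> sqrt (disagreement Q)"
proof -
  fix i :: 'v
  \<comment> \<open>Copying the matrix of one vertex to all vertices stays inside the rotations,
    which averaging the matrices would not.\<close>
  define P :: "real^'n^'n^'v" where "P = (\<chi> j. Q$i)"
  have "P \<in> consensus_set"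
    using assms by (simp add: P_def consensus_set_def SO_product_def)
  then have "infdist Q consensus_set \<le> dist Q P"
    by (rule infdist_le)
  also have "\<dots> = sqrt (\<Sum>j\<in>UNIV. (norm (Q$i - Q$j))\<^sup>2)"
    unfolding dist_vec_def[of Q P] L2_set_def
    by (simp add: P_def dist_norm norm_minus_commute)
  also have "\<dots> \<le> sqrt (disagreement Q)"
    unfolding disagreement_def
    by (intro real_sqrt_le_mono member_le_sum[where f = "\<lambda>i. \<Sum>j\<in>UNIV. (norm (Q$i - Q$j))\<^sup>2"])
      (auto intro: sum_nonneg)
  finally show ?thesis .
qed

text \<open>Any consensus point is a common midpoint for the triangle inequality, giving
  \<open>2 * dist Q P\<close> per pair; the root of the number of ordered pairs gives
  \<open>CARD('v)\<close>.\<close>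

lemma disagreement_le_infdist_consensus_set:
  fixes Q :: "real^'n^'n^'v::finite"
  shows "sqrt (disagreement Q) \<le> 2 * CARD('v) * infdist Q consensus_set"
proof -
  define k where "k = real CARD('v)"
  have "k > 0"
    by (simp add: k_def)
  \<comment> \<open>Nonemptiness ensures that \<open>infdist\<close> is a genuine infimum and not
    its default value 0.\<close>
  have "(\<chi> i. mat 1) \<in> (consensus_set :: (real^'n^'n^'v) set)"
    by (simp add: consensus_set_def SO_product_def rotation_matrix_def orthogonal_matrix_id)
  then have ne: "consensus_set \<noteq> ({} :: (real^'n^'n^'v) set)"
    by blast
  have "sqrt (disagreement Q) \<le> 2 * k * dist Q P" if "P \<in> consensus_set" for P
  proof (rule real_le_lsqrt)
    have "norm (Q$i - Q$j) \<le> 2 * dist Q P" for i j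
    proof -
      have "P$i = P$j"
        using that by (auto simp: consensus_set_def)
      then have "norm (Q$i - Q$j) \<le> dist (Q$i) (P$i) + dist (Q$j) (P$j)"
        using norm_triangle_ineq4[of "Q$i - P$i" "Q$j - P$j"] by (simp add: dist_norm)
      also have "\<dots> \<le> 2 * dist Q P"
        using dist_vec_nth_le[of Q i P] dist_vec_nth_le[of Q j P] by simp
      finally show ?thesis .
    qed
    then have "disagreement Q \<le> (\<Sum>i\<in>(UNIV::'v set). \<Sum>j\<in>(UNIV::'v set). (2 * dist Q P)\<^sup>2)"
      unfolding disagreement_def by (intro sum_mono power_mono) auto
    also have "\<dots> = (2 * k * dist Q P)\<^sup>2"
      by (simp add: k_def power2_eq_square)
    finally show "disagreement Q \<le> (2 * k * dist Q P)\<^sup>2" .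
  qed (simp add: k_def)
  then have "sqrt (disagreement Q) / (2 * k) \<le> infdist Q consensus_set"
    unfolding infdist_notempty[OF ne] using \<open>k > 0\<close>
    by (intro cINF_greatest ne) (simp add: field_simps)
  then show ?thesis
    using \<open>k > 0\<close> by (simp add: k_def field_simps)
qed

text \<open>Differentiating a squared norm gives a factor 2; the contributions of the two ends of a
  pair agree after exchanging the indices, which gives another 2.\<close>

lemma disagreement_has_derivative:
  fixes x :: "real \<Rightarrow> real^'n^'n^'v::finite"
  assumes "(x has_vector_derivative x') (at t within S)"
  shows "((\<lambda>t. disagreement (x t)) has_real_derivative
    4 * (\<Sum>i\<in>UNIV. \<Sum>l\<in>UNIV. x'$i \<bullet> (x t $ i - x t $ l))) (at t within S)"
proof -
  have comp: "((\<lambda>t. x t $ i) has_vector_derivative x' $ i) (at t within S)" for i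
    using bounded_linear.has_vector_derivative[OF bounded_linear_vec_nth assms] .
  have diff: "((\<lambda>t. x t $ i - x t $ l) has_vector_derivative x' $ i - x' $ l) (at t within S)" for i l
    by (intro has_vector_derivative_diff comp)
  have "((\<lambda>t. disagreement (x t)) has_vector_derivative
      (\<Sum>i\<in>UNIV. \<Sum>l\<in>UNIV. (x t $ i - x t $ l) \<bullet> (x'$i - x'$l) + (x'$i - x'$l) \<bullet> (x t $ i - x t $ l)))
      (at t within S)"
    unfolding disagreement_def power2_norm_eq_inner
    by (intro has_vector_derivative_sum bounded_bilinear.has_vector_derivative[OF bounded_bilinear_inner] diff)
  moreover have "(\<Sum>i\<in>UNIV. \<Sum>l\<in>UNIV. (x t $ i - x t $ l) \<bullet> (x'$i - x'$l) + (x'$i - x'$l) \<bullet> (x t $ i - x t $ l))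
      = (\<Sum>i\<in>UNIV. \<Sum>l\<in>UNIV. 2 * (x'$i \<bullet> (x t $ i - x t $ l)) + 2 * (x'$l \<bullet> (x t $ l - x t $ i)))"
    by (intro sum.cong refl) (simp add: inner_diff_left inner_diff_right inner_commute)
  moreover have "(\<Sum>i\<in>UNIV. \<Sum>l\<in>UNIV. x'$l \<bullet> (x t $ l - x t $ i))
      = (\<Sum>i\<in>UNIV. \<Sum>l\<in>UNIV. x'$i \<bullet> (x t $ i - x t $ l))"
    by (rule sum.swap)
  ultimately show ?thesis
    by (simp add: has_real_derivative_iff_has_vector_derivative sum.distrib sum_distrib_left[symmetric])
qed

subsection \<open>Averaging\<close>

text \<open>The near-identity transformation of averaging theory, applied to the Lyapunov function
  instead of the state. The coefficient matches the quadratic term in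
  \<open>disagreement_decrease\<close>, so that \<open>N\<close> can cancel it.\<close>

definition corrected_disagreement ::
  "('v::finite \<times> 'v) set \<Rightarrow> real \<Rightarrow> ('v \<Rightarrow> 'v \<Rightarrow> real^'n^'n) \<Rightarrow> real^'n^'n^'v \<Rightarrow> real" where
  "corrected_disagreement E \<epsilon> N Q = disagreement Q
    - 2 * \<epsilon> * CARD('v) * (\<Sum>(i, j)\<in>E. (N i j ** (Q$j - Q$i)) \<bullet> (Q$j - Q$i))"

lemma corrected_disagreement_bound:
  fixes Q :: "real^'n^'n^'v::finite"
  assumes "\<epsilon> \<ge> 0" and N: "\<And>i j. (i, j) \<in> E \<Longrightarrow> norm (N i j) \<le> T" and "T \<ge> 0"
  shows "\<bar>corrected_disagreement E \<epsilon> N Q - disagreement Q\<bar> \<le> 2 * \<epsilon> * CARD('v) * T * disagreement Q"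
proof -
  have "\<bar>\<Sum>(i, j)\<in>E. (N i j ** (Q$j - Q$i)) \<bullet> (Q$j - Q$i)\<bar> \<le> (\<Sum>(i, j)\<in>E. T * (norm (Q$j - Q$i))\<^sup>2)"
    unfolding case_prod_unfold
  proof (rule sum_norm_le[where 'a = real, unfolded real_norm_def])
    fix e assume e: "e \<in> E"
    define D where "D = Q $ snd e - Q $ fst e"
    have "\<bar>(N (fst e) (snd e) ** D) \<bullet> D\<bar> \<le> norm (N (fst e) (snd e) ** D) * norm D"
      by (rule Cauchy_Schwarz_ineq2)
    also have "\<dots> \<le> (T * norm D) * norm D"
      using N[of "fst e" "snd e"] e
      by (intro mult_right_mono order_trans[OF norm_matrix_mult_le]) auto
    finally show "\<bar>(N (fst e) (snd e) ** (Q $ snd e - Q $ fst e)) \<bullet> (Q $ snd e - Q $ fst e)\<bar>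
        \<le> T * (norm (Q $ snd e - Q $ fst e))\<^sup>2"
      by (simp add: D_def power2_eq_square)
  qed
  also have "\<dots> = T * (\<Sum>(i, j)\<in>E. (norm (Q$j - Q$i))\<^sup>2)"
    by (simp add: sum_distrib_left case_prod_unfold)
  also have "\<dots> \<le> T * disagreement Q"
    by (intro mult_left_mono edge_difference_le_disagreement \<open>T \<ge> 0\<close>)
  finally have "2 * \<epsilon> * CARD('v) * \<bar>\<Sum>(i, j)\<in>E. (N i j ** (Q$j - Q$i)) \<bullet> (Q$j - Q$i)\<bar>
      \<le> 2 * \<epsilon> * CARD('v) * (T * disagreement Q)"
    using \<open>\<epsilon> \<ge> 0\<close> by (intro mult_left_mono) auto
  then show ?thesis
    using \<open>\<epsilon> \<ge> 0\<close> by (simp add: corrected_disagreement_def abs_mult mult.assoc)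
qed

lemma corrected_disagreement_has_derivative:
  fixes x :: "real \<Rightarrow> real^'n^'n^'v::finite"
  assumes x: "(x has_vector_derivative x') (at t within S)"
    and N: "\<And>i j. (i, j) \<in> E \<Longrightarrow> (N i j has_vector_derivative N' i j) (at t within S)"
  shows "((\<lambda>t. corrected_disagreement E \<epsilon> (\<lambda>i j. N i j t) (x t)) has_real_derivative
    4 * (\<Sum>i\<in>UNIV. \<Sum>l\<in>UNIV. x'$i \<bullet> (x t $ i - x t $ l))
    - 2 * \<epsilon> * CARD('v) * (\<Sum>(i, j)\<in>E.
        (N i j t ** (x t $ j - x t $ i)) \<bullet> (x'$j - x'$i)
        + (N i j t ** (x'$j - x'$i) + N' i j ** (x t $ j - x t $ i)) \<bullet> (x t $ j - x t $ i))) (at t within S)"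
proof -
  have comp: "((\<lambda>t. x t $ i) has_vector_derivative x' $ i) (at t within S)" for i
    using bounded_linear.has_vector_derivative[OF bounded_linear_vec_nth x] .
  have diff: "((\<lambda>t. x t $ j - x t $ i) has_vector_derivative x' $ j - x' $ i) (at t within S)" for i j
    by (intro has_vector_derivative_diff comp)
  have "((\<lambda>t. \<Sum>(i, j)\<in>E. (N i j t ** (x t $ j - x t $ i)) \<bullet> (x t $ j - x t $ i)) has_vector_derivative
      (\<Sum>(i, j)\<in>E. (N i j t ** (x t $ j - x t $ i)) \<bullet> (x'$j - x'$i)
        + (N i j t ** (x'$j - x'$i) + N' i j ** (x t $ j - x t $ i)) \<bullet> (x t $ j - x t $ i))) (at t within S)"
    unfolding case_prod_unfold
    by (intro has_vector_derivative_sum diff N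
        bounded_bilinear.has_vector_derivative[OF bounded_bilinear_inner]
        bounded_bilinear.has_vector_derivative[OF bounded_bilinear_matrix_mult]) simp
  then show ?thesis
    unfolding corrected_disagreement_def has_real_derivative_iff_has_vector_derivative[symmetric]
    by (intro DERIV_diff disagreement_has_derivative[OF x] DERIV_cmult)
qed

text \<open>With \<open>A - M\<close> as derivative of the corrector, the oscillating forms cancel
  and the coercive \<open>A\<close> remains. Where the derivative falls on the differences of
  \<open>Q\<close> instead, the field supplies another factor \<open>\<epsilon>\<close>.\<close>

lemma corrected_disagreement_decrease:
  fixes E :: "('v::finite \<times> 'v) set" and Q :: "real^'n^'n^'v" and \<epsilon> t T \<mu> c :: real
    and M :: "'v \<Rightarrow> 'v \<Rightarrow> real \<Rightarrow> real^'n^'n"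
  defines "F \<equiv> consensus_field E M \<epsilon> t Q"
  assumes Q: "Q \<in> SO_product" and "\<epsilon> \<ge> 0" and "sym E" and "T \<ge> 0"
    and M: "\<And>i j. (i, j) \<in> E \<Longrightarrow> M i j t = M j i t"
      "\<And>i j. (i, j) \<in> E \<Longrightarrow> transpose (M i j t) = M i j t"
      "\<And>i j. (i, j) \<in> E \<Longrightarrow> norm (M i j t) \<le> 1"
    and N: "\<And>i j. (i, j) \<in> E \<Longrightarrow> norm (N i j) \<le> T"
    and A: "\<And>i j D. (i, j) \<in> E \<Longrightarrow> \<mu> * (norm D)\<^sup>2 \<le> (A i j ** D) \<bullet> (D :: real^'n^'n)"
    and "\<mu> \<ge> 0" and c: "c * disagreement Q \<le> (\<Sum>(i, j)\<in>E. (norm (Q$j - Q$i))\<^sup>2)"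
  shows "4 * (\<Sum>i\<in>UNIV. \<Sum>l\<in>UNIV. F $ i \<bullet> (Q$i - Q$l))
    - 2 * \<epsilon> * CARD('v) * (\<Sum>(i, j)\<in>E. (N i j ** (Q$j - Q$i)) \<bullet> (F$j - F$i)
        + (N i j ** (F$j - F$i) + (A i j - M i j t) ** (Q$j - Q$i)) \<bullet> (Q$j - Q$i))
    \<le> 2 * \<epsilon> * CARD('v) * (- (\<mu> * c) + card E * CARD('n) * sqrt (disagreement Q)
        + 4 * T * card E * CARD('v) * (1 + CARD('n)) * \<epsilon>) * disagreement Q"
proof -
  define V where "V = disagreement Q"
  define d where "d = sqrt V"
  have "V \<ge> 0" and "d \<ge> 0" and d2: "d * d = V"
    by (simp_all add: V_def d_def disagreement_nonneg)
  define f where "f = \<epsilon> * (CARD('v) * (1 + CARD('n))) * d"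
  have "f \<ge> 0"
    using \<open>\<epsilon> \<ge> 0\<close> \<open>d \<ge> 0\<close> by (simp add: f_def)
  have F: "norm (F $ i) \<le> f" for i
    unfolding F_def f_def d_def V_def
    using Q \<open>\<epsilon> \<ge> 0\<close> M(2,3) by (intro norm_consensus_field_le) auto
  define dM where "dM = (\<Sum>(i, j)\<in>E. (M i j t ** (Q$j - Q$i)) \<bullet> (Q$j - Q$i))"
  \<comment> \<open>The form of \<open>M\<close> is kept exactly, since it has to cancel against
    \<open>dM\<close>. The two terms with \<open>F\<close> cost \<open>2 * T * f * d\<close>
    each.\<close>
  have "(\<Sum>(i, j)\<in>E. \<mu> * (norm (Q$j - Q$i))\<^sup>2 - 4 * T * f * d - (M i j t ** (Q$j - Q$i)) \<bullet> (Q$j - Q$i))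
      \<le> (\<Sum>(i, j)\<in>E. (N i j ** (Q$j - Q$i)) \<bullet> (F$j - F$i)
        + (N i j ** (F$j - F$i) + (A i j - M i j t) ** (Q$j - Q$i)) \<bullet> (Q$j - Q$i))"
  proof (rule sum_mono, clarify)
    fix i j assume ij: "(i, j) \<in> E"
    define D where "D = Q$j - Q$i"
    define D' where "D' = F$j - F$i"
    have D: "norm D \<le> d"
      unfolding D_def d_def V_def by (rule norm_diff_le_disagreement)
    have D': "norm D' \<le> 2 * f"
      using norm_triangle_ineq4[of "F$j" "F$i"] F[of i] F[of j] by (simp add: D'_def)
    have "\<bar>(N i j ** D) \<bullet> D'\<bar> \<le> norm (N i j ** D) * norm D'"
      by (rule Cauchy_Schwarz_ineq2)
    also have "\<dots> \<le> (T * d) * (2 * f)"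
      using N[OF ij] D D' \<open>T \<ge> 0\<close> \<open>d \<ge> 0\<close>
      by (intro mult_mono order_trans[OF norm_matrix_mult_le]) auto
    finally have 1: "\<bar>(N i j ** D) \<bullet> D'\<bar> \<le> 2 * T * f * d"
      by (simp add: mult_ac)
    have "\<bar>(N i j ** D') \<bullet> D\<bar> \<le> norm (N i j ** D') * norm D"
      by (rule Cauchy_Schwarz_ineq2)
    also have "\<dots> \<le> (T * (2 * f)) * d"
      using N[OF ij] D D' \<open>T \<ge> 0\<close> \<open>f \<ge> 0\<close>
      by (intro mult_mono order_trans[OF norm_matrix_mult_le]) auto
    finally have 2: "\<bar>(N i j ** D') \<bullet> D\<bar> \<le> 2 * T * f * d"
      by (simp add: mult_ac)
    have "(N i j ** D' + (A i j - M i j t) ** D) \<bullet> D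
        = (N i j ** D') \<bullet> D + (A i j ** D) \<bullet> D - (M i j t ** D) \<bullet> D"
      by (simp add: matrix_diff_rdistrib inner_diff_left inner_add_left)
    then have "\<mu> * (norm D)\<^sup>2 - 4 * T * f * d - (M i j t ** D) \<bullet> D
        \<le> (N i j ** D) \<bullet> D' + (N i j ** D' + (A i j - M i j t) ** D) \<bullet> D"
      using 1 2 A[OF ij, of D] by linarith
    then show "\<mu> * (norm (Q$j - Q$i))\<^sup>2 - 4 * T * f * d - (M i j t ** (Q$j - Q$i)) \<bullet> (Q$j - Q$i)
      \<le> (N i j ** (Q$j - Q$i)) \<bullet> (F$j - F$i)
        + (N i j ** (F$j - F$i) + (A i j - M i j t) ** (Q$j - Q$i)) \<bullet> (Q$j - Q$i)"
      by (simp add: D_def D'_def)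
  qed
  also have "(\<Sum>(i, j)\<in>E. \<mu> * (norm (Q$j - Q$i))\<^sup>2 - 4 * T * f * d - (M i j t ** (Q$j - Q$i)) \<bullet> (Q$j - Q$i))
      = \<mu> * (\<Sum>(i, j)\<in>E. (norm (Q$j - Q$i))\<^sup>2) - card E * (4 * T * f * d) - dM"
    by (simp add: case_prod_unfold sum_subtractf sum_distrib_left dM_def)
  finally have S: "\<mu> * (\<Sum>(i, j)\<in>E. (norm (Q$j - Q$i))\<^sup>2) - card E * (4 * T * f * d) - dM
      \<le> (\<Sum>(i, j)\<in>E. (N i j ** (Q$j - Q$i)) \<bullet> (F$j - F$i)
        + (N i j ** (F$j - F$i) + (A i j - M i j t) ** (Q$j - Q$i)) \<bullet> (Q$j - Q$i))" (is "_ \<le> ?S") .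
  have "\<mu> * c * V \<le> \<mu> * (\<Sum>(i, j)\<in>E. (norm (Q$j - Q$i))\<^sup>2)"
    using c \<open>\<mu> \<ge> 0\<close> by (simp add: V_def mult.assoc mult_left_mono)
  moreover have "f * d = \<epsilon> * (CARD('v) * (1 + CARD('n))) * V"
    by (simp add: f_def d2[symmetric] mult.assoc)
  then have "card E * (4 * T * f * d) = 4 * T * card E * CARD('v) * (1 + CARD('n)) * \<epsilon> * V"
    by (simp add: mult.assoc) (simp add: algebra_simps)
  ultimately have "\<mu> * c * V - 4 * T * card E * CARD('v) * (1 + CARD('n)) * \<epsilon> * V - dM \<le> ?S"
    using S by linarith
  then have "2 * \<epsilon> * CARD('v) * (\<mu> * c * V - 4 * T * card E * CARD('v) * (1 + CARD('n)) * \<epsilon> * V - dM)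
      \<le> 2 * \<epsilon> * CARD('v) * ?S"
    using \<open>\<epsilon> \<ge> 0\<close> by (intro mult_left_mono) auto
  moreover have "4 * (\<Sum>i\<in>UNIV. \<Sum>l\<in>UNIV. F $ i \<bullet> (Q$i - Q$l))
      \<le> - 2 * \<epsilon> * CARD('v) * dM + 2 * \<epsilon> * (CARD('v) * card E * CARD('n)) * d * V"
    unfolding F_def dM_def d_def V_def
    using Q \<open>\<epsilon> \<ge> 0\<close> \<open>sym E\<close> M by (intro disagreement_decrease) auto
  ultimately show ?thesis
    unfolding V_def[symmetric] d_def[symmetric] by (simp add: algebra_simps)
qed

section \<open>Uniform positivity of the window means\<close>

lemma uniform_coercivity:
  fixes A :: "'e \<Rightarrow> real^'n^'n"
  assumes "finite S" and "\<And>e. e \<in> S \<Longrightarrow> positive_definite (A e)"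
  obtains \<mu> where "\<mu> > 0" "\<And>e x. e \<in> S \<Longrightarrow> \<mu> * (norm x)\<^sup>2 \<le> x \<bullet> (A e *v x)"
proof -
  have "\<forall>e\<in>S. \<exists>\<mu>>0. \<forall>x. \<mu> * (norm x)\<^sup>2 \<le> x \<bullet> (A e *v x)"
    using assms(2) positive_definite_coercive by metis
  then obtain \<mu> where \<mu>: "\<And>e. e \<in> S \<Longrightarrow> \<mu> e > 0"
      "\<And>e x. e \<in> S \<Longrightarrow> \<mu> e * (norm x)\<^sup>2 \<le> x \<bullet> (A e *v x)"
    by metis
  show ?thesis
  proof
    \<comment> \<open>The inserted 1 keeps the minimum meaningful for empty
      \<open>S\<close>.\<close>
    show "Min (insert 1 (\<mu> ` S)) > 0"
      using \<mu>(1) \<open>finite S\<close> by simp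
    show "Min (insert 1 (\<mu> ` S)) * (norm x)\<^sup>2 \<le> x \<bullet> (A e *v x)" if "e \<in> S" for e x
      using \<open>finite S\<close> that
      by (intro order_trans[OF mult_right_mono \<mu>(2)]) auto
  qed
qed

text \<open>A perturbation argument: the window mean lies within \<open>\<nu>\<close> of
  \<open>Mbar\<close> in norm, so by Cauchy-Schwarz its form loses at most
  \<open>\<nu>\<close>.\<close>

lemma moving_average_coercive:
  fixes M :: "real \<Rightarrow> real^'n^'n" and D :: "real^'m^'n"
  assumes "continuous_on UNIV M" and "T > 0"
    and coercive: "\<And>x. \<mu> * (norm x)\<^sup>2 \<le> x \<bullet> (Mbar *v x)"
    and close: "frobenius_norm (integral {t..t+T} (\<lambda>s. M s - Mbar)) \<le> T * \<nu>"
  shows "(\<mu> - \<nu>) * (norm D)\<^sup>2 \<le> (((1/T) *\<^sub>R integral {t..t+T} M) ** D) \<bullet> D"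
proof -
  define A where "A = (1/T) *\<^sub>R integral {t..t+T} M"
  have "M integrable_on {t..t+T}"
    using assms(1) by (intro integrable_continuous_real) (rule continuous_on_subset, auto)
  then have "integral {t..t+T} (\<lambda>s. M s - Mbar) = T *\<^sub>R (A - Mbar)"
    using \<open>T > 0\<close> by (simp add: A_def Henstock_Kurzweil_Integration.integral_diff integrable_const_ivl scaleR_diff_right)
  then have "norm (A - Mbar) \<le> \<nu>"
    using close \<open>T > 0\<close> by (simp add: frobenius_norm_eq_norm)
  moreover have "\<bar>((A - Mbar) ** D) \<bullet> D\<bar> \<le> norm (A - Mbar) * norm D * norm D"
    by (rule order_trans[OF Cauchy_Schwarz_ineq2]) (simp add: mult_right_mono norm_matrix_mult_le)
  ultimately have "\<bar>((A - Mbar) ** D) \<bullet> D\<bar> \<le> \<nu> * (norm D)\<^sup>2"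
    by (smt (verit) mult.assoc mult_right_mono power2_eq_square zero_le_power2)
  moreover have "(A ** D) \<bullet> D = (Mbar ** D) \<bullet> D + ((A - Mbar) ** D) \<bullet> D"
    by (simp add: matrix_diff_rdistrib inner_diff_left)
  moreover have "\<mu> * (norm D)\<^sup>2 \<le> (Mbar ** D) \<bullet> D"
    by (rule matrix_mult_inner_ge) (rule coercive)
  ultimately show ?thesis
    unfolding A_def[symmetric] by (simp add: algebra_simps)
qed

section \<open>Choice of the constants and exponential stability\<close>

theorem theorem3:
  fixes E :: "('v::finite \<times> 'v) set"
    and y :: "'v \<Rightarrow> 'v \<Rightarrow> real \<Rightarrow> real^'n"
    and M :: "'v \<Rightarrow> 'v \<Rightarrow> real \<Rightarrow> real^'n^'n"
    and Mbar :: "'v \<Rightarrow> 'v \<Rightarrow> real^'n^'n"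
  assumes "CARD('v) > 2" and "CARD('n) \<ge> 2"
    and "simple_graph E" and "connected_graph E"
    and "\<And>i j. (i, j) \<in> E \<Longrightarrow> y i j = y j i"
    and "\<And>i j t. (i, j) \<in> E \<Longrightarrow> y i j t \<in> sphere 0 1"
    and "\<And>i j. (i, j) \<in> E \<Longrightarrow> smooth (y i j)"
    and "\<And>i j t. M i j t = outer_square (y i j t)"
    and "\<And>i j. (i, j) \<in> E \<Longrightarrow>
           ((\<lambda>t. (1 / (2 * t)) *\<^sub>R integral {-t..t} (M i j)) \<longlongrightarrow> Mbar i j) at_top"
    and "\<And>i j. (i, j) \<in> E \<Longrightarrow> positive_definite (Mbar i j)"
    and "\<exists>Z :: real \<Rightarrow> real. (\<forall>T\<ge>0. Z T \<ge> 0) \<and> ((\<lambda>t. (1 / t) * Z t) \<longlongrightarrow> 0) at_top \<and>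
           (\<forall>t. \<forall>(i, j)\<in>E. \<forall>T\<ge>0.
              frobenius_norm (integral {t..t + T} (\<lambda>s. M i j s - Mbar i j)) \<le> Z T)"
  shows "\<exists>\<epsilon>0>0. \<forall>\<epsilon>. 0 < \<epsilon> \<and> \<epsilon> < \<epsilon>0 \<longrightarrow>
           locally_exponentially_stable SO_product (consensus_field E M \<epsilon>)
             (consensus_set :: (real^'n^'n^'v) set)"
proof -
  have "sym E"
    using assms(3) by (simp add: simple_graph_def)
  have M: "M i j t = M j i t" "transpose (M i j t) = M i j t" "norm (M i j t) \<le> 1"
      "continuous_on UNIV (M i j)" if "(i, j) \<in> E" for i j t
  proof -
    show "M i j t = M j i t" "transpose (M i j t) = M i j t"
      using assms(5)[OF that] by (simp_all add: assms(8))
    show "norm (M i j t) \<le> 1"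
      using assms(6)[OF that] by (simp add: assms(8) norm_outer_square)
    show "continuous_on UNIV (M i j)"
      using continuous_on_outer_square[OF smooth_imp_continuous_on[OF assms(7)[OF that]]]
      by (simp add: assms(8)[abs_def])
  qed
  \<comment> \<open>Half of \<open>2 * \<mu>\<close> is to be spent on the distance between window
    means and \<open>Mbar\<close>; the other half survives.\<close>
  obtain \<mu> where "\<mu> > 0" and
    \<mu>: "\<And>i j x. (i, j) \<in> E \<Longrightarrow> 2 * \<mu> * (norm x)\<^sup>2 \<le> x \<bullet> (Mbar i j *v x)"
  proof -
    obtain \<mu> where "\<mu> > 0" "\<And>e x. e \<in> E \<Longrightarrow> \<mu> * (norm x)\<^sup>2 \<le> x \<bullet> (case_prod Mbar e *v x)"
      using uniform_coercivity[of E "case_prod Mbar"] assms(10) by auto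
    then show ?thesis
      using that[of "\<mu> / 2"] by fastforce
  qed
  \<comment> \<open>As \<open>Z T / T\<close> tends to 0, one window length serves all times and
    edges; it is fixed before \<open>\<epsilon>\<close>.\<close>
  obtain T where "T > 0" and
    T: "\<And>t i j. (i, j) \<in> E \<Longrightarrow>
      frobenius_norm (integral {t..t + T} (\<lambda>s. M i j s - Mbar i j)) \<le> T * \<mu>"
  proof -
    obtain Z where Z: "((\<lambda>t. (1 / t) * Z t) \<longlongrightarrow> 0) at_top"
      and bound: "\<And>t i j T. (i, j) \<in> E \<Longrightarrow> T \<ge> 0 \<Longrightarrow>
        frobenius_norm (integral {t..t + T} (\<lambda>s. M i j s - Mbar i j)) \<le> Z T"
      using assms(11) by blast
    have "\<forall>\<^sub>F t in at_top. (1 / t) * Z t < \<mu> \<and> t > 0"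
      using order_tendstoD(2)[OF Z \<open>\<mu> > 0\<close>] eventually_gt_at_top by (rule eventually_conj)
    then obtain T where "(1 / T) * Z T < \<mu>" and "T > 0"
      using eventually_happens[of _ at_top] by force
    then have "Z T \<le> T * \<mu>" "T \<ge> 0"
      by (simp_all add: field_simps)
    then show ?thesis
      using that[of T] \<open>T > 0\<close> bound[of _ _ T] by (meson order_trans)
  qed
  have A: "\<mu> * (norm D)\<^sup>2 \<le> (((1/T) *\<^sub>R integral {t..t+T} (M i j)) ** D) \<bullet> D"
    if "(i, j) \<in> E" for i j t and D :: "real^'n^'n"
    using moving_average_coercive[OF M(4)[OF that] \<open>T > 0\<close> \<mu>[OF that] T[OF that]] by simp
  have "\<exists>N. (\<forall>t. (N has_vector_derivative (1/T) *\<^sub>R integral {t..t+T} (M i j) - M i j t) (at t))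
      \<and> (\<forall>t. norm (N t) \<le> T)" if "(i, j) \<in> E" for i j
    using moving_average_corrector[OF M(4)[OF that] M(3)[OF that] \<open>T > 0\<close>] by (metis mult_1)
  then obtain N where N: "\<And>i j t. (i, j) \<in> E \<Longrightarrow>
        (N i j has_vector_derivative (1/T) *\<^sub>R integral {t..t+T} (M i j) - M i j t) (at t)"
      "\<And>i j t. (i, j) \<in> E \<Longrightarrow> norm (N i j t) \<le> T"
    by metis
  obtain c where "c > 0" and c: "\<And>Q :: real^'n^'n^'v.
      c * disagreement Q \<le> (\<Sum>(i, j)\<in>E. (norm (Q$j - Q$i))\<^sup>2)"
    using disagreement_le_edge_difference[OF assms(4)] by blast
  define k where "k = real CARD('v)"
  define K1 where "K1 = real (card E * CARD('n))"
  define K2 where "K2 = 4 * T * card E * CARD('v) * (1 + CARD('n))"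
  have "k > 0" "K1 \<ge> 0" "K2 \<ge> 0"
    using \<open>T > 0\<close> by (simp_all add: k_def K1_def K2_def)
  \<comment> \<open>A quarter of the rate \<open>\<mu> * c\<close>: the cubic term and the
    \<open>\<epsilon>\<close> term may each consume one quarter, leaving
    \<open>2 * \<eta>\<close>.\<close>
  define \<eta> where "\<eta> = \<mu> * c / 4"
  have "\<eta> > 0"
    using \<open>\<mu> > 0\<close> \<open>c > 0\<close> by (simp add: \<eta>_def)
  \<comment> \<open>The first bound makes \<open>U\<close> and \<open>V\<close> comparable, the
    second gives \<open>K2 * \<epsilon> \<le> \<eta>\<close>. The \<open>+ 1\<close> here and in
    \<open>\<rho>\<close> rules out division by zero.\<close>
  define \<epsilon>0 where "\<epsilon>0 = min (1 / (4 * k * T)) (\<eta> / (K2 + 1))"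
  \<comment> \<open>While the root of the disagreement is at most \<open>\<rho>\<close>, the cubic
    term costs no more than \<open>\<eta>\<close>.\<close>
  define \<rho> where "\<rho> = \<eta> / (K1 + 1)"
  have "\<epsilon>0 > 0" "\<rho> > 0"
    using \<open>\<eta> > 0\<close> \<open>k > 0\<close> \<open>T > 0\<close> \<open>K1 \<ge> 0\<close> \<open>K2 \<ge> 0\<close> by (simp_all add: \<epsilon>0_def \<rho>_def)
  have "K1 * \<rho> \<le> \<eta>"
    using \<open>\<eta> > 0\<close> \<open>K1 \<ge> 0\<close> by (simp add: \<rho>_def field_simps)
  have "locally_exponentially_stable SO_product (consensus_field E M \<epsilon>)
      (consensus_set :: (real^'n^'n^'v) set)" if \<epsilon>: "0 < \<epsilon>" "\<epsilon> < \<epsilon>0" for \<epsilon>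
  proof -
    have "\<epsilon> * (K2 + 1) \<le> \<eta>"
      using \<epsilon> \<open>K2 \<ge> 0\<close> by (simp add: \<epsilon>0_def pos_less_divide_eq)
    then have K2: "K2 * \<epsilon> \<le> \<eta>"
      using \<epsilon> by (simp add: algebra_simps)
    have "\<epsilon> * (4 * k * T) \<le> 1"
      using \<epsilon> \<open>k > 0\<close> \<open>T > 0\<close> by (simp add: \<epsilon>0_def pos_less_divide_eq)
    then have small: "2 * \<epsilon> * k * T \<le> 1/2"
      by (simp add: mult_ac)
    define r where "r = 2 * \<epsilon> * k * \<eta>"
    have "r > 0"
      using \<epsilon> \<open>k > 0\<close> \<open>\<eta> > 0\<close> by (simp add: r_def)
    \<comment> \<open>\<open>V\<close> behaves like a squared distance, so the rate of
      \<open>U\<close> is halved. In \<open>4 * k\<close>, a factor 2 comes from passing between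
      \<open>U\<close> and \<open>V\<close>, and \<open>2 * k\<close> from passing between
      \<open>V\<close> and the distance.\<close>
    have decay: "infdist (x t) consensus_set
        \<le> 4 * k * exp (- (r / 2) * (t - t0)) * infdist (x t0) consensus_set"
      if sol: "solution_on SO_product (consensus_field E M \<epsilon>) {t0..t1} x"
        and init: "infdist (x t0) consensus_set < \<rho> / (4 * k)" and t: "t \<in> {t0..t1}"
      for t0 t1 t and x :: "real \<Rightarrow> real^'n^'n^'v"
    proof -
      have SO: "x s \<in> SO_product" if "s \<in> {t0..t1}" for s
        using sol that by (simp add: solution_on_def)
      define V where "V s = disagreement (x s)" for s
      define U where "U s = corrected_disagreement E \<epsilon> (\<lambda>i j. N i j s) (x s)" for s
      have V_nonneg: "V s \<ge> 0" for s
        by (simp add: V_def disagreement_nonneg)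
      have UV: "V s \<le> 2 * U s" "U s \<le> 3/2 * V s" for s
      proof -
        have "\<bar>U s - V s\<bar> \<le> 2 * \<epsilon> * k * T * V s"
          unfolding U_def V_def k_def
          using \<epsilon> \<open>T > 0\<close> N(2) by (intro corrected_disagreement_bound) auto
        also have "\<dots> \<le> 1/2 * V s"
          by (intro mult_right_mono small V_nonneg)
        finally show "V s \<le> 2 * U s" "U s \<le> 3/2 * V s"
          by linarith+
      qed
      \<comment> \<open>The barrier \<open>\<rho>\<^sup>2 / 2\<close> for \<open>U\<close> is chosen
        so that \<open>V s \<le> 2 * U s\<close> keeps \<open>V s\<close> below
        \<open>\<rho>\<^sup>2\<close>.\<close>
      have "\<exists>U'. (U has_real_derivative U') (at s within {t0..t1})
          \<and> (U s < \<rho>\<^sup>2 / 2 \<longrightarrow> U' \<le> - r * U s)" if s: "s \<in> {t0..t1}" for s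
      proof -
        define F where "F = consensus_field E M \<epsilon> s (x s)"
        define U' where "U' = 4 * (\<Sum>i\<in>UNIV. \<Sum>l\<in>UNIV. F $ i \<bullet> (x s $ i - x s $ l))
          - 2 * \<epsilon> * CARD('v) * (\<Sum>(i, j)\<in>E. (N i j s ** (x s $ j - x s $ i)) \<bullet> (F$j - F$i)
            + (N i j s ** (F$j - F$i) + ((1/T) *\<^sub>R integral {s..s+T} (M i j) - M i j s)
                ** (x s $ j - x s $ i)) \<bullet> (x s $ j - x s $ i))"
        have "(U has_real_derivative U') (at s within {t0..t1})"
          unfolding U_def[abs_def] U'_def
        proof (rule corrected_disagreement_has_derivative)
          show "(x has_vector_derivative F) (at s within {t0..t1})"
            using sol s by (simp add: solution_on_def F_def)
        qed (use N(1) has_vector_derivative_at_within in blast)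
        moreover have U': "U' \<le> 2 * \<epsilon> * k * (- (\<mu> * c) + K1 * sqrt (V s) + K2 * \<epsilon>) * V s"
          unfolding U'_def F_def V_def k_def K1_def K2_def
          using SO[OF s] \<epsilon> \<open>sym E\<close> \<open>T > 0\<close> \<open>\<mu> > 0\<close> M(1-3) N(2) A c
          by (intro corrected_disagreement_decrease) auto
        have "U' \<le> - r * U s" if "U s < \<rho>\<^sup>2 / 2"
        proof -
          have "sqrt (V s) \<le> \<rho>"
            using that UV(1)[of s] \<open>\<rho> > 0\<close> by (intro real_le_lsqrt) auto
          then have "K1 * sqrt (V s) \<le> \<eta>"
            using \<open>K1 * \<rho> \<le> \<eta>\<close> \<open>K1 \<ge> 0\<close> by (meson mult_left_mono order_trans)
          then have "- (\<mu> * c) + K1 * sqrt (V s) + K2 * \<epsilon> \<le> - 2 * \<eta>"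
            using K2 by (simp add: \<eta>_def)
          then have "2 * \<epsilon> * k * (- (\<mu> * c) + K1 * sqrt (V s) + K2 * \<epsilon>) * V s
              \<le> 2 * \<epsilon> * k * (- 2 * \<eta>) * V s"
            using \<epsilon> \<open>k > 0\<close> V_nonneg by (intro mult_right_mono mult_left_mono) auto
          also have "\<dots> = - r * (2 * V s)"
            by (simp add: r_def)
          also have "\<dots> \<le> - r * U s"
            using UV(2)[of s] V_nonneg[of s] \<open>r > 0\<close> by simp
          finally show ?thesis
            using U' by simp
        qed
        ultimately show ?thesis
          by blast
      qed
      then obtain U' where U': "\<And>s. s \<in> {t0..t1} \<Longrightarrow> (U has_real_derivative U' s) (at s within {t0..t1})"
          "\<And>s. s \<in> {t0..t1} \<Longrightarrow> U s < \<rho>\<^sup>2 / 2 \<Longrightarrow> U' s \<le> - r * U s"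
        by metis
      have U_nonneg: "U s \<ge> 0" for s
        using UV(1)[of s] V_nonneg[of s] by simp
      have V0: "sqrt (V t0) \<le> 2 * k * infdist (x t0) consensus_set"
        using disagreement_le_infdist_consensus_set[of "x t0"] by (simp add: V_def k_def)
      also have "\<dots> < \<rho> / 2"
        using init \<open>k > 0\<close> by (simp add: field_simps)
      finally have "(sqrt (V t0))\<^sup>2 < (\<rho> / 2)\<^sup>2"
        by (intro power_strict_mono) (auto simp: V_nonneg)
      then have "V t0 < \<rho>\<^sup>2 / 4"
        using V_nonneg by (simp add: power_divide)
      \<comment> \<open>By \<open>UV\<close>, \<open>U t0\<close> is below
        \<open>3/8 * \<rho>\<^sup>2\<close>.\<close>
      then have "U t0 < \<rho>\<^sup>2 / 2"
        using UV(2)[of t0] \<open>\<rho> > 0\<close> zero_less_power[of \<rho> 2] by linarith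
      have "U t \<le> exp (- r * (t - t0)) * U t0"
        using barrier_exponential_decay[OF U'(1) U_nonneg \<open>U t0 < \<rho>\<^sup>2 / 2\<close> _ U'(2) t] \<open>r > 0\<close>
        by simp
      then have "V t \<le> 2 * (exp (- r * (t - t0)) * U t0)"
        using UV(1)[of t] by simp
      \<comment> \<open>Rounding 3/2 up to 2 turns the overall constant into the perfect square
        4.\<close>
      also have "\<dots> \<le> 2 * (exp (- r * (t - t0)) * (2 * V t0))"
        using UV(2)[of t0] V_nonneg[of t0] by simp
      also have "\<dots> = (2 * exp (- (r / 2) * (t - t0)) * sqrt (V t0))\<^sup>2"
        using V_nonneg[of t0]
        by (simp add: power_mult_distrib power2_eq_square[of "exp _"] exp_add[symmetric] field_simps)
      finally have "sqrt (V t) \<le> 2 * exp (- (r / 2) * (t - t0)) * sqrt (V t0)"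
        using V_nonneg by (intro real_le_lsqrt) auto
      also have "\<dots> \<le> 2 * exp (- (r / 2) * (t - t0)) * (2 * k * infdist (x t0) consensus_set)"
        by (intro mult_left_mono V0) auto
      finally show ?thesis
        using infdist_consensus_set_le[OF SO[OF t]] by (simp add: V_def mult_ac)
    qed
    show ?thesis
      unfolding locally_exponentially_stable_def
    proof (intro exI conjI allI impI ballI)
      \<comment> \<open>The radius and the overshoot constant do not depend on
        \<open>\<epsilon>\<close>; the rate is proportional to it.\<close>
      show "\<rho> / (4 * k) > 0" "4 * k > 0" "r / 2 > 0"
        using \<open>\<rho> > 0\<close> \<open>k > 0\<close> \<open>r > 0\<close> by simp_all
    qed (rule decay)
  qed
  then show ?thesis
    using \<open>\<epsilon>0 > 0\<close> by blast
qed

end
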